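(* Let $n>q\ge 4$, let $\mathbf{d}=(d_1,\dots,d_n)$ be a non-increasing sequence of positive integers with $d_i\ge 2$ for $i\le q$, $d_i=1$ for $i>q$, and $d_1+\dots+d_n=2(n-1)$, and let $\mathbf{w}=(\mu_1,\dots,\mu_n)$ be non-negative reals, indexed so that $d_i=d_j$, $i<j$ implies $\mu_i\ge\mu_j$, and monotone in $\mathbf{d}$. Suppose $\mu_{2i-1}=\mu_{2i}$ and $d_{2i-1}=d_{2i}$ for $i=1,\dots,\lfloor q/2\rfloor$, and $\mu_{q+2i-1}=\mu_{q+2i}$ for $i=1,\dots,\lfloor (n-q)/2\rfloor$. Then there exists $T\in\mathcal{WT}(\mathbf{w},\mathbf{d})$ with $VWWI(T)=UB(\mathbf{w},\mathbf{d})$, where $$UB(\mathbf{w},\mathbf{d}):=\mu\Big[\tfrac{q+1}{4}\mu+\sum_{i=1}^q\mu_i\Big]-\sum_{i=q+1}^n\mu_i^2-\sum_{k=1}^{\lceil q/2\rceil}2M_k\Big[kM_k+2\sum_{l=1}^{k-1}lM_l\Big],$$ with $\mu:=\sum_{i=1}^n\mu_i$; $D_0:=0$, $D_1:=d_1+d_2-2$, $D_k:=2+\sum_{i=1}^{2k}(d_i-2)$ for $2\le k\le\lfloor q/2\rfloor$; $M_k:=\frac12\big(\mu_{2k-1}+\mu_{2k}+\sum_{i=1+D_{k-1}}^{D_k}\mu_{q+i}\big)$ for $k=1,\dots,\lfloor q/2\rfloor$; and $M_{\lfloor q/2\rfloor+1}:=\frac12\big(\mu_q+\sum_{i=0}^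{d_q-3}\mu_{n-i}\big)$.
   Context: For a tree $T$, $d_T(v)$ is the degree of $v$ and $d_T(u,v)$ the distance. A vertex-weighted tree has weights $\mu_T(v)$ on vertices; $VWWI(T)=\frac12\sum_{u,v\in V(T)}\mu_T(u)\mu_T(v)d_T(u,v)$. $\mathcal{WT}(\mathbf{w},\mathbf{d})$ is the set of vertex-weighted trees whose vertices can be labeled $v_1,\dots,v_n$ with $d_T(v_i)=d_i$, $\mu_T(v_i)=\mu_i$. $\mathbf{w}$ is monotone in $\mathbf{d}$ if $d_i,d_j\ge2$ and $i<j$ imply $\mu_i\ge\mu_j$.
   Formalization: In UB the sum in the first bracket is taken over the pendant vertices, i=q+1,…,n, instead of i=1,…,q; as printed the claim fails for d=(2,2,2,2,1,1), w=(0,0,0,0,1,1), where the only tree has VWWI 5 but the printed UB is 1. *)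

theory Defs
  imports Complex_Main
begin

record 'a weighted_graph =
  verts :: "'a set"
  edges :: "'a set set"
  weight :: "'a \<Rightarrow> real"

definition simple_graph :: "('a, 'b) weighted_graph_scheme \<Rightarrow> bool" where
  "simple_graph G \<longleftrightarrow> finite (verts G) \<and>
     (\<forall>e \<in> edges G. \<exists>u v. u \<in> verts G \<and> v \<in> verts G \<and> u \<noteq> v \<and> e = {u, v})"

definition walk :: "('a, 'b) weighted_graph_scheme \<Rightarrow> 'a list \<Rightarrow> bool" where
  "walk G xs \<longleftrightarrow> xs \<noteq> [] \<and> set xs \<subseteq> verts G \<and>
     (\<forall>i. Suc i < length xs \<longrightarrow> {xs ! i, xs ! Suc i} \<in> edges G)"

definition walk_betw :: "('a, 'b) weighted_graph_scheme \<Rightarrow> 'a \<Rightarrow> 'a list \<Rightarrow> 'a \<Rightarrow> bool" where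
  "walk_betw G u xs v \<longleftrightarrow> walk G xs \<and> hd xs = u \<and> last xs = v"

definition connected_graph :: "('a, 'b) weighted_graph_scheme \<Rightarrow> bool" where
  "connected_graph G \<longleftrightarrow> verts G \<noteq> {} \<and>
     (\<forall>u \<in> verts G. \<forall>v \<in> verts G. \<exists>xs. walk_betw G u xs v)"

definition graph_cycle :: "('a, 'b) weighted_graph_scheme \<Rightarrow> 'a list \<Rightarrow> bool" where
  "graph_cycle G xs \<longleftrightarrow> walk G xs \<and> 3 \<le> length xs \<and> distinct xs \<and> {last xs, hd xs} \<in> edges G"

definition is_tree :: "('a, 'b) weighted_graph_scheme \<Rightarrow> bool" where
  "is_tree G \<longleftrightarrow> simple_graph G \<and> connected_graph G \<and> (\<nexists>xs. graph_cycle G xs)"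

definition degree :: "('a, 'b) weighted_graph_scheme \<Rightarrow> 'a \<Rightarrow> nat" where
  "degree G v = card {e \<in> edges G. v \<in> e}"

text \<open>A walk is given by its list of vertices, so its length is one less than that of the list.\<close>

definition graph_dist :: "('a, 'b) weighted_graph_scheme \<Rightarrow> 'a \<Rightarrow> 'a \<Rightarrow> nat" where
  "graph_dist G u v = (LEAST k. \<exists>xs. walk_betw G u xs v \<and> length xs = Suc k)"

definition VWWI :: "('a, 'b) weighted_graph_scheme \<Rightarrow> real" where
  "VWWI T = 1 / 2 * (\<Sum>u \<in> verts T. \<Sum>v \<in> verts T.
     weight T u * weight T v * real (graph_dist T u v))"

text \<open>
  Sequences \<open>\<mu>\<^sub>1, \<dots>, \<mu>\<^sub>n\<close> and \<open>d\<^sub>1, \<dots>, d\<^sub>n\<close> are functions on \<^typ>\<open>nat\<close>, of which only the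
  values on \<open>{1..n}\<close> matter.
\<close>

definition WT :: "nat \<Rightarrow> (nat \<Rightarrow> real) \<Rightarrow> (nat \<Rightarrow> nat) \<Rightarrow> 'a weighted_graph set" where
  "WT n \<mu> d = {T. is_tree T \<and> (\<exists>v. bij_betw v {1..n} (verts T) \<and>
     (\<forall>i \<in> {1..n}. degree T (v i) = d i \<and> weight T (v i) = \<mu> i))}"

definition monotone_in :: "nat \<Rightarrow> (nat \<Rightarrow> real) \<Rightarrow> (nat \<Rightarrow> nat) \<Rightarrow> bool" where
  "monotone_in n \<mu> d \<longleftrightarrow>
     (\<forall>i \<in> {1..n}. \<forall>j \<in> {1..n}. 2 \<le> d i \<and> 2 \<le> d j \<and> i < j \<longrightarrow> \<mu> i \<ge> \<mu> j)"

text \<open>The subtractions below are exact, because \<open>d\<^sub>i \<ge> 2\<close> for every index \<open>i \<le> q\<close>.\<close>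

definition D :: "(nat \<Rightarrow> nat) \<Rightarrow> nat \<Rightarrow> nat" where
  "D d k = (if k = 0 then 0
            else if k = 1 then d 1 + d 2 - 2
            else 2 + (\<Sum>i = 1..2 * k. d i - 2))"

text \<open>
  The range \<open>{..<d\<^sub>q - 2}\<close> is \<open>{0..d\<^sub>q - 3}\<close> read over the integers, i.e. empty for \<open>d\<^sub>q = 2\<close>.
  The second branch is used for \<open>k = \<lfloor>q/2\<rfloor> + 1\<close> only, with \<open>q\<close> odd.
\<close>

definition M :: "nat \<Rightarrow> nat \<Rightarrow> (nat \<Rightarrow> real) \<Rightarrow> (nat \<Rightarrow> nat) \<Rightarrow> nat \<Rightarrow> real" where
  "M n q \<mu> d k =
     (if k \<le> q div 2
      then 1 / 2 * (\<mu> (2 * k - 1) + \<mu> (2 * k) + (\<Sum>i = 1 + D d (k - 1)..D d k. \<mu> (q + i)))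
      else 1 / 2 * (\<mu> q + (\<Sum>i<d q - 2. \<mu> (n - i))))"

text \<open>
  The sum in the first bracket runs over the pendant vertices \<open>q + 1, \<dots>, n\<close>: together with
  \<open>- \<Sum>\<mu>\<^sub>i\<^sup>2\<close> it is the contribution \<open>\<Sum>\<mu>\<^sub>i (\<mu> - \<mu>\<^sub>i)\<close> of the pendant edges. The source prints
  \<open>\<Sum>\<^sub>i\<^sub>=\<^sub>1\<^sup>q \<mu>\<^sub>i\<close> there, which cannot be meant: for \<open>q = 4\<close>, \<open>n = 6\<close>, \<open>d = (2,2,2,2,1,1)\<close> and
  \<open>\<mu> = (0,0,0,0,1,1)\<close> the only tree is the path on six vertices, whose index is 5, but the
  printed expression is 1.
\<close>

definition UB :: "nat \<Rightarrow> nat \<Rightarrow> (nat \<Rightarrow> real) \<Rightarrow> (nat \<Rightarrow> nat) \<Rightarrow> real" where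
  "UB n q \<mu> d = (let \<mu>tot = (\<Sum>i = 1..n. \<mu> i) in
     \<mu>tot * ((real q + 1) / 4 * \<mu>tot + (\<Sum>i = q + 1..n. \<mu> i))
     - (\<Sum>i = q + 1..n. (\<mu> i)\<^sup>2)
     - (\<Sum>k = 1..nat \<lceil>real q / 2\<rceil>. 2 * M n q \<mu> d k *
          (real k * M n q \<mu> d k + 2 * (\<Sum>l = 1..<k. real l * M n q \<mu> d l))))"

end

theory Submission
  imports Defs
begin

text \<open>
  The extremal tree is a caterpillar whose spine reads \<open>1, 3, 5, \<dots>, 6, 4, 2\<close>. Since weights and
  degrees come in pairs, the leaves can be attached so that the weight at the \<open>k\<close>-th spine position
  from either end is \<open>M\<^sub>k\<close> (and \<open>2 M\<^sub>k\<close> at the centre of a spine of odd length). The pendant edges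
  contribute \<open>\<Sum> \<mu>\<^sub>i (\<mu> - \<mu>\<^sub>i)\<close>. On the spine, the two masses \<open>M\<^sub>k\<close> and the two masses \<open>M\<^sub>l\<close> have
  total mutual distance \<open>2 (q + 1) - 4 min k l\<close>, and the sum of \<open>M\<^sub>k M\<^sub>l min k l\<close> over all
  \<open>k, l\<close> is the last sum in \<open>UB\<close> up to a factor.
\<close>

section \<open>Walks, distances and cycles\<close>

lemma walk_iff_successively:
  "walk G xs \<longleftrightarrow> xs \<noteq> [] \<and> set xs \<subseteq> verts G \<and> successively (\<lambda>x y. {x, y} \<in> edges G) xs"
  by (simp add: walk_def successively_conv_nth)

lemma walk_betw_singleton: "u \<in> verts G \<Longrightarrow> walk_betw G u [u] u"
  by (simp add: walk_betw_def walk_iff_successively)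

lemma walk_betw_Cons:
  assumes "walk_betw G v xs w" "{u, v} \<in> edges G" "u \<in> verts G"
  shows "walk_betw G u (u # xs) w"
  using assms by (auto simp: walk_betw_def walk_iff_successively successively_Cons)

lemma walk_betw_snoc:
  assumes "walk_betw G u xs v" "{v, w} \<in> edges G" "w \<in> verts G"
  shows "walk_betw G u (xs @ [w]) w"
  using assms by (auto simp: walk_betw_def walk_iff_successively successively_append_iff)

lemma potential_last_le_walk:
  fixes \<psi> :: "'a \<Rightarrow> nat"
  assumes "\<And>x y. {x, y} \<in> edges G \<Longrightarrow> \<psi> y \<le> Suc (\<psi> x)" and "walk G xs"
  shows "Suc (\<psi> (last xs)) \<le> \<psi> (hd xs) + length xs"
  using assms(2)
proof (induction xs)
  case (Cons x xs)
  show ?case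
  proof (cases "xs = []")
    case False
    then have "\<psi> (hd xs) \<le> Suc (\<psi> x)" "walk G xs"
      using Cons.prems assms(1) by (auto simp: walk_iff_successively successively_Cons)
    then show ?thesis using Cons.IH False by simp
  qed simp
qed (simp add: walk_def)

lemma walk_betw_of_descent:
  fixes \<psi> :: "'a \<Rightarrow> nat"
  assumes "u \<in> verts G" "\<psi> u = 0"
    and descent: "\<And>v. v \<in> verts G \<Longrightarrow> v \<noteq> u \<Longrightarrow>
      \<exists>v' \<in> verts G. {v', v} \<in> edges G \<and> \<psi> v = Suc (\<psi> v')"
    and "v \<in> verts G"
  shows "\<exists>xs. walk_betw G u xs v \<and> length xs = Suc (\<psi> v)"
  using \<open>v \<in> verts G\<close>
proof (induction "\<psi> v" arbitrary: v rule: less_induct)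
  case less
  show ?case
  proof (cases "v = u")
    case True
    then show ?thesis using walk_betw_singleton[OF assms(1)] \<open>\<psi> u = 0\<close> by fastforce
  next
    case False
    then obtain v' where v': "v' \<in> verts G" "{v', v} \<in> edges G" "\<psi> v = Suc (\<psi> v')"
      using descent less.prems by blast
    then obtain xs where "walk_betw G u xs v'" "length xs = Suc (\<psi> v')"
      using less.hyps by auto
    then show ?thesis using walk_betw_snoc[OF _ v'(2) less.prems] v'(3)
      by (intro exI[of _ "xs @ [v]"]) simp
  qed
qed

lemma graph_dist_eqI:
  fixes \<psi> :: "'a \<Rightarrow> nat"
  assumes "u \<in> verts G" "\<psi> u = 0"
    and lipschitz: "\<And>x y. {x, y} \<in> edges G \<Longrightarrow> \<psi> y \<le> Suc (\<psi> x)"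
    and descent: "\<And>v. v \<in> verts G \<Longrightarrow> v \<noteq> u \<Longrightarrow>
      \<exists>v' \<in> verts G. {v', v} \<in> edges G \<and> \<psi> v = Suc (\<psi> v')"
    and "v \<in> verts G"
  shows "graph_dist G u v = \<psi> v"
  unfolding graph_dist_def
proof (rule Least_equality)
  show "\<exists>xs. walk_betw G u xs v \<and> length xs = Suc (\<psi> v)"
    using walk_betw_of_descent[of u G \<psi>] assms by blast
next
  fix k
  assume "\<exists>xs. walk_betw G u xs v \<and> length xs = Suc k"
  then show "\<psi> v \<le> k"
    using potential_last_le_walk[of G \<psi>, OF lipschitz] \<open>\<psi> u = 0\<close> by (fastforce simp: walk_betw_def)
qed

lemma graph_cycle_two_neighbours:
  assumes "graph_cycle G xs" "x \<in> set xs"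
  obtains y z where "y \<in> set xs" "z \<in> set xs" "y \<noteq> z" "{x, y} \<in> edges G" "{x, z} \<in> edges G"
proof -
  obtain ys zs where split: "xs = ys @ x # zs" using assms(2) by (auto simp: in_set_conv_decomp)
  have closing: "{last xs, hd xs} \<in> edges G" and "distinct xs" "3 \<le> length xs"
    and step: "successively (\<lambda>x y. {x, y} \<in> edges G) xs"
    using assms(1) by (auto simp: graph_cycle_def walk_iff_successively)
  define y where "y = last (if ys = [] then zs else ys)"
  define z where "z = hd (if zs = [] then ys else zs)"
  have nonempty: "ys \<noteq> [] \<or> zs \<noteq> []" using \<open>3 \<le> length xs\<close> split by auto
  have "y \<in> set ys \<union> set zs" "z \<in> set ys \<union> set zs" using nonempty by (auto simp: y_def z_def)
  moreover have "y \<noteq> z"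
  proof (cases "ys = [] \<or> zs = []")
    case True
    then have "y = last (ys @ zs)" "z = hd (ys @ zs)" by (auto simp: y_def z_def)
    moreover have "distinct (ys @ zs)" "2 \<le> length (ys @ zs)"
      using \<open>distinct xs\<close> \<open>3 \<le> length xs\<close> split by auto
    ultimately show ?thesis by (cases "ys @ zs") auto
  next
    case False
    then have "y \<in> set ys" "z \<in> set zs" by (simp_all add: y_def z_def)
    then show ?thesis using \<open>distinct xs\<close> split by auto
  qed
  moreover have "{x, y} \<in> edges G" "{x, z} \<in> edges G"
    using step closing nonempty unfolding split y_def z_def
    by (auto simp: successively_append_iff successively_Cons insert_commute)
  ultimately show thesis using that split by auto
qed

section \<open>Rooted trees\<close>

locale rooted_tree =
  fixes V :: "'a set" and root :: 'a and parent :: "'a \<Rightarrow> 'a" and rank :: "'a \<Rightarrow> nat"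
    and w :: "'a \<Rightarrow> real"
  assumes finite_V: "finite V" and root_in: "root \<in> V"
    and parent_in: "x \<in> V - {root} \<Longrightarrow> parent x \<in> V"
    and rank_parent_less: "x \<in> V - {root} \<Longrightarrow> rank (parent x) < rank x"
begin

definition tree :: "'a weighted_graph" where
  "tree = \<lparr>verts = V, edges = (\<lambda>x. {x, parent x}) ` (V - {root}), weight = w\<rparr>"

lemma verts_tree [simp]: "verts tree = V" and weight_tree [simp]: "weight tree = w"
  by (simp_all add: tree_def)

lemma edges_tree: "edges tree = (\<lambda>x. {x, parent x}) ` (V - {root})"
  by (simp add: tree_def)

lemma edge_iff:
  "{x, y} \<in> edges tree \<longleftrightarrow> (x \<in> V - {root} \<and> y = parent x) \<or> (y \<in> V - {root} \<and> x = parent y)"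
  unfolding edges_tree by (auto simp: doubleton_eq_iff)

lemma simple_graph_tree: "simple_graph tree"
  using finite_V parent_in rank_parent_less unfolding simple_graph_def edges_tree by fastforce

lemma connected_graph_tree: "connected_graph tree"
proof -
  have up: "\<exists>xs. walk_betw tree u xs root" if "u \<in> V" for u
    using that
  proof (induction "rank u" arbitrary: u rule: less_induct)
    case less
    then show ?case
      using walk_betw_singleton[of root tree] walk_betw_Cons[of tree "parent u" _ root u]
        parent_in[of u] rank_parent_less[of u] root_in
      by (cases "u = root") (auto simp: edge_iff)
  qed
  have "\<exists>xs. walk_betw tree u xs v" if "u \<in> V" "v \<in> V" for u v
    using \<open>v \<in> V\<close>
  proof (induction "rank v" arbitrary: v rule: less_induct)
    case less
    then show ?case
      using up[OF \<open>u \<in> V\<close>] walk_betw_snoc[of tree u _ "parent v" v]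
        parent_in[of v] rank_parent_less[of v]
      by (cases "v = root") (auto simp: edge_iff)
  qed
  then show ?thesis using root_in by (auto simp: connected_graph_def)
qed

text \<open>A vertex of maximal rank on a cycle would have both of its cycle neighbours as parent.\<close>

lemma acyclic_tree: "\<not> graph_cycle tree xs"
proof
  assume cycle: "graph_cycle tree xs"
  then have "Max (rank ` set xs) \<in> rank ` set xs" by (auto simp: graph_cycle_def walk_def)
  then obtain x where maximal: "Max (rank ` set xs) = rank x" "x \<in> set xs" by (rule imageE)
  have neighbour: "y = parent x" if "y \<in> set xs" "{x, y} \<in> edges tree" for y
    using that maximal rank_parent_less[of y] Max_ge[of "rank ` set xs" "rank y"] by (auto simp: edge_iff)
  from cycle maximal(2) show False
    by (rule graph_cycle_two_neighbours) (use neighbour in blast)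
qed

lemma is_tree_tree: "is_tree tree"
  by (simp add: is_tree_def simple_graph_tree connected_graph_tree acyclic_tree)

lemma degree_tree:
  assumes "v \<in> V"
  shows "degree tree v = of_bool (v \<noteq> root) + card {x \<in> V - {root}. parent x = v}"
proof -
  let ?X = "V - {root}"
  let ?children = "{x \<in> ?X. parent x = v}"
  have inj: "inj_on (\<lambda>x. {x, parent x}) ?X"
  proof (rule inj_onI)
    fix x y
    assume "x \<in> ?X" "y \<in> ?X" "{x, parent x} = {y, parent y}"
    then show "x = y"
      using rank_parent_less[of x] rank_parent_less[of y] by (auto simp: doubleton_eq_iff)
  qed
  have "{e \<in> edges tree. v \<in> e} = (\<lambda>x. {x, parent x}) ` ({x \<in> ?X. x = v} \<union> ?children)"
    unfolding edges_tree by auto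
  then have "degree tree v = card ({x \<in> ?X. x = v} \<union> ?children)"
    unfolding degree_def by (simp only: card_image inj_on_subset[OF inj] Un_least Collect_restrict)
  also have "\<dots> = card {x \<in> ?X. x = v} + card ?children"
    using finite_V rank_parent_less[of v] by (intro card_Un_disjoint) auto
  also have "{x \<in> ?X. x = v} = (if v = root then {} else {v})" using assms by auto
  finally show ?thesis by simp
qed

end

section \<open>Caterpillars\<close>

text \<open>The position of a leaf is that of the spine vertex to which it is attached.\<close>

locale caterpillar =
  fixes S L :: "'a set" and q :: nat and pos :: "'a \<Rightarrow> nat" and w :: "'a \<Rightarrow> real"
  assumes q_pos: "1 \<le> q" and finite_L: "finite L" and disjoint: "S \<inter> L = {}"
    and bij_pos: "bij_betw pos S {1..q}" and pos_leaf: "x \<in> L \<Longrightarrow> pos x \<in> {1..q}"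
begin

definition spine_at :: "nat \<Rightarrow> 'a" where
  "spine_at = the_inv_into S pos"

definition spine_start :: 'a where
  "spine_start = spine_at 1"

definition parent :: "'a \<Rightarrow> 'a" where
  "parent x = spine_at (if x \<in> S then pos x - 1 else pos x)"

definition height :: "'a \<Rightarrow> nat" where
  "height x = of_bool (x \<in> L)"

lemma pos_in: "x \<in> S \<union> L \<Longrightarrow> pos x \<in> {1..q}"
  using bij_pos pos_leaf by (auto simp: bij_betw_def)

lemma spine_at_in: "p \<in> {1..q} \<Longrightarrow> spine_at p \<in> S"
  and pos_spine_at: "p \<in> {1..q} \<Longrightarrow> pos (spine_at p) = p"
  and spine_at_pos: "x \<in> S \<Longrightarrow> spine_at (pos x) = x"
  using bij_pos unfolding spine_at_def bij_betw_def
  by (auto intro: the_inv_into_into f_the_inv_into_f the_inv_into_f_f)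

lemma spine_start_in: "spine_start \<in> S" and pos_spine_start: "pos spine_start = 1"
  using spine_at_in[of 1] pos_spine_at[of 1] q_pos by (simp_all add: spine_start_def)

lemma height_spine: "x \<in> S \<Longrightarrow> height x = 0" and height_leaf: "x \<in> L \<Longrightarrow> height x = 1"
  using disjoint by (auto simp: height_def)

lemma non_rootE:
  assumes "x \<in> S \<union> L - {spine_start}"
  obtains (spine) "x \<in> S" "parent x \<in> S" "pos x = Suc (pos (parent x))"
    | (leaf) "x \<in> L" "parent x \<in> S" "pos (parent x) = pos x"
proof (cases "x \<in> S")
  case True
  then have "pos x \<noteq> 1" using assms spine_at_pos[of x] by (auto simp: spine_start_def)
  then obtain p where "pos x = Suc p" "p \<in> {1..q}" using pos_in[of x] assms by (cases "pos x") auto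
  then show thesis using spine True spine_at_in pos_spine_at by (simp add: parent_def)
next
  case False
  then show thesis
    using leaf assms pos_leaf[of x] spine_at_in pos_spine_at by (simp add: parent_def)
qed

sublocale rooted_tree "S \<union> L" spine_start parent "\<lambda>x. pos x + height x" w
proof
  show "finite (S \<union> L)" using finite_L bij_betw_finite[OF bij_pos] by simp
  show "spine_start \<in> S \<union> L" using spine_start_in by simp
  fix x assume x: "x \<in> S \<union> L - {spine_start}"
  then show "parent x \<in> S \<union> L" by (rule non_rootE) auto
  from x show "pos (parent x) + height (parent x) < pos x + height x"
    by (rule non_rootE) (auto simp: height_spine height_leaf)
qed

lemma spine_edge:
  assumes "p \<in> {1..<q}"
  shows "{spine_at p, spine_at (Suc p)} \<in> edges tree"
proof -
  have "spine_at (Suc p) \<in> S" "pos (spine_at (Suc p)) = Suc p" "spine_at (Suc p) \<noteq> spine_start"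
    using assms spine_at_in[of "Suc p"] pos_spine_at[of "Suc p"] pos_spine_start by auto
  then show ?thesis by (auto simp: edge_iff parent_def)
qed

lemma leaf_edge:
  assumes "x \<in> L"
  shows "{spine_at (pos x), x} \<in> edges tree"
proof -
  have "x \<notin> S" "x \<noteq> spine_start" using assms disjoint spine_start_in by auto
  then show ?thesis using assms by (simp add: edge_iff parent_def)
qed

text \<open>One of the two truncated differences vanishes, so that their sum is the absolute difference.\<close>

definition hops :: "'a \<Rightarrow> 'a \<Rightarrow> nat" where
  "hops u v = (if u = v then 0 else (pos u - pos v) + (pos v - pos u) + height u + height v)"

lemma hops_lipschitz:
  assumes "{x, y} \<in> edges tree"
  shows "hops u y \<le> Suc (hops u x)"
proof -
  have "hops u (parent x) \<le> Suc (hops u x)" "hops u x \<le> Suc (hops u (parent x))"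
    if "x \<in> S \<union> L - {spine_start}" for x
  proof -
    from that consider "pos x = Suc (pos (parent x))" "height x = 0" "height (parent x) = 0"
      | "pos (parent x) = pos x" "height x = 1" "height (parent x) = 0"
      by (rule non_rootE) (auto simp: height_spine height_leaf)
    then show "hops u (parent x) \<le> Suc (hops u x)" "hops u x \<le> Suc (hops u (parent x))"
      by (cases; auto simp: hops_def)+
  qed
  then show ?thesis using assms unfolding edge_iff by blast
qed

lemma spine_neighbour_towards:
  assumes "v \<in> S" "j \<in> {1..q}" "pos v \<noteq> j"
  obtains v' where "v' \<in> S" "{v', v} \<in> edges tree"
    "(j - pos v) + (pos v - j) = Suc ((j - pos v') + (pos v' - j))"
proof (cases "pos v < j")
  case True
  define v' where "v' = spine_at (Suc (pos v))"
  have "pos v \<in> {1..<q}" using True assms pos_in[of v] by auto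
  then have "v' \<in> S" "pos v' = Suc (pos v)" "{v', v} \<in> edges tree"
    using spine_edge[of "pos v"] spine_at_in[of "Suc (pos v)"] pos_spine_at[of "Suc (pos v)"]
      spine_at_pos[OF assms(1)]
    by (auto simp: v'_def insert_commute)
  then show thesis using that True by simp
next
  case False
  then obtain p where p: "pos v = Suc p" "p \<in> {1..<q}"
    using assms pos_in[of v] by (cases "pos v") auto
  have "spine_at p \<in> S" "pos (spine_at p) = p" "{spine_at p, v} \<in> edges tree"
    using p spine_edge[of p] spine_at_in[of p] pos_spine_at[of p] spine_at_pos[OF assms(1)] by auto
  then show thesis using that False p assms(3) by simp
qed

lemma hops_descent:
  assumes "u \<in> S \<union> L" "v \<in> S \<union> L" "v \<noteq> u"
  shows "\<exists>v' \<in> S \<union> L. {v', v} \<in> edges tree \<and> hops u v = Suc (hops u v')"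
proof -
  consider (leaf) "v \<in> L" | (spine_foot) "v \<in> S" "pos u = pos v"
    | (spine_far) "v \<in> S" "pos v \<noteq> pos u"
    using assms(2) by force
  then show ?thesis
  proof cases
    case leaf
    have "spine_at (pos v) \<in> S" "pos (spine_at (pos v)) = pos v"
      using spine_at_in pos_spine_at pos_leaf[OF leaf] by auto
    moreover from this have "hops u v = Suc (hops u (spine_at (pos v)))"
      using leaf assms height_leaf height_spine by (auto simp: hops_def)
    ultimately show ?thesis using leaf_edge[OF leaf] by blast
  next
    case spine_foot
    then have "u \<in> L" "v = spine_at (pos u)" using assms spine_at_pos by (metis UnE)+
    moreover from this spine_foot have "hops u v = Suc (hops u u)"
      using assms(3) by (simp add: hops_def height_spine height_leaf)
    ultimately show ?thesis using leaf_edge[of u] by (auto simp: insert_commute)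
  next
    case spine_far
    then obtain v' where v': "v' \<in> S" "{v', v} \<in> edges tree"
      "(pos u - pos v) + (pos v - pos u) = Suc ((pos u - pos v') + (pos v' - pos u))"
      using spine_neighbour_towards[of v "pos u"] pos_in[OF assms(1)] by blast
    then have "hops u v = Suc (hops u v')"
      using spine_far assms(3) height_spine by (auto simp: hops_def)
    then show ?thesis using v' by blast
  qed
qed

lemma graph_dist_tree:
  assumes "u \<in> S \<union> L" "v \<in> S \<union> L"
  shows "graph_dist tree u v = hops u v"
proof (rule graph_dist_eqI)
  show "hops u u = 0" by (simp add: hops_def)
  fix v'
  assume "v' \<in> verts tree" "v' \<noteq> u"
  then show "\<exists>v'' \<in> verts tree. {v'', v'} \<in> edges tree \<and> hops u v' = Suc (hops u v'')"
    using hops_descent assms by simp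
qed (use assms in \<open>simp_all only: verts_tree hops_lipschitz\<close>)

lemma degree_leaf:
  assumes "v \<in> L"
  shows "degree tree v = 1"
proof -
  have "parent x \<in> S" if "x \<in> S \<union> L - {spine_start}" for x
    using that by (rule non_rootE)
  then have no_child: "{x \<in> S \<union> L - {spine_start}. parent x = v} = {}"
    using assms disjoint by blast
  then show ?thesis using degree_tree[of v] assms disjoint spine_start_in unfolding no_child by auto
qed

lemma degree_spine:
  assumes "v \<in> S"
  shows "degree tree v = of_bool (1 < pos v) + of_bool (pos v < q) + card {x \<in> L. pos x = pos v}"
proof -
  have "1 \<le> pos v" "pos v \<le> q" using pos_in[of v] assms by auto
  have children: "{x \<in> S \<union> L - {spine_start}. parent x = v} =
      (if pos v < q then {spine_at (Suc (pos v))} else {}) \<union> {x \<in> L. pos x = pos v}"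
    (is "?C = ?N \<union> ?P")
  proof (intro set_eqI iffI)
    fix x assume "x \<in> ?C"
    then have "x \<in> S \<union> L - {spine_start}" "parent x = v" by auto
    then show "x \<in> ?N \<union> ?P"
      using spine_at_pos[of x] pos_in[of x] by (cases rule: non_rootE) auto
  next
    fix x assume "x \<in> ?N \<union> ?P"
    then show "x \<in> ?C"
      using assms \<open>1 \<le> pos v\<close> \<open>pos v \<le> q\<close> disjoint spine_at_in[of "Suc (pos v)"]
        pos_spine_at[of "Suc (pos v)"] pos_spine_start spine_start_in spine_at_pos[OF assms] q_pos
      by (auto simp: parent_def split: if_splits)
  qed
  have "card ?C = card ?N + card ?P"
    unfolding children
    using finite_L disjoint spine_at_in[of "Suc (pos v)"] by (intro card_Un_disjoint) auto
  moreover have "v \<noteq> spine_start \<longleftrightarrow> 1 < pos v"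
    using \<open>1 \<le> pos v\<close> spine_at_pos[OF assms] pos_spine_start
    by (cases "pos v = 1") (auto simp: spine_start_def)
  ultimately show ?thesis using degree_tree[of v] assms by simp
qed

lemma VWWI_tree:
  "VWWI tree = 1 / 2 * (\<Sum>u \<in> S \<union> L. \<Sum>v \<in> S \<union> L. w u * w v * \<bar>real (pos u) - real (pos v)\<bar>)
     + (\<Sum>u \<in> S \<union> L. w u) * (\<Sum>u \<in> L. w u) - (\<Sum>u \<in> L. (w u)\<^sup>2)"
proof -
  let ?V = "S \<union> L" and ?h = "\<lambda>u. real (height u)"
  have hops: "real (hops u v) =
      \<bar>real (pos u) - real (pos v)\<bar> + ?h u + ?h v - (if v = u then 2 * ?h u else 0)" for u v
    by (auto simp: hops_def)
  have leaves: "(\<Sum>u\<in>?V. F u * ?h u) = (\<Sum>u\<in>L. F u)" for F :: "'a \<Rightarrow> real"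
    using finite_V by (intro sum.mono_neutral_cong_right) (auto simp: height_def)
  have "(\<Sum>u\<in>?V. \<Sum>v\<in>?V. w u * w v * real (hops u v)) =
     (\<Sum>u\<in>?V. \<Sum>v\<in>?V. w u * w v * \<bar>real (pos u) - real (pos v)\<bar>
        + (w u * ?h u) * w v + w u * (w v * ?h v) - (if v = u then 2 * ((w u)\<^sup>2 * ?h u) else 0))"
    unfolding hops by (intro sum.cong refl) (auto simp: algebra_simps power2_eq_square)
  also have "\<dots> = (\<Sum>u\<in>?V. \<Sum>v\<in>?V. w u * w v * \<bar>real (pos u) - real (pos v)\<bar>)
      + (\<Sum>u\<in>?V. w u * ?h u) * (\<Sum>v\<in>?V. w v) + (\<Sum>u\<in>?V. w u) * (\<Sum>v\<in>?V. w v * ?h v)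
      - 2 * (\<Sum>u\<in>?V. (w u)\<^sup>2 * ?h u)"
    using finite_V
    by (simp add: sum.distrib sum_subtractf flip: sum_distrib_left sum_distrib_right)
  finally show ?thesis
    unfolding VWWI_def leaves by (simp add: graph_dist_tree algebra_simps)
qed

end

section \<open>Mirror-symmetric mass distributions\<close>

text \<open>
  For odd \<open>q\<close> the mirror positions \<open>k\<close> and \<open>q + 1 - k\<close> coincide at the centre, which then carries
  the mass \<open>2 * m k\<close>.
\<close>

definition mirror_symmetric ::
  "'a set \<Rightarrow> ('a \<Rightarrow> real) \<Rightarrow> ('a \<Rightarrow> nat) \<Rightarrow> nat \<Rightarrow> (nat \<Rightarrow> real) \<Rightarrow> bool" where
  "mirror_symmetric V w p q m \<longleftrightarrow> (\<forall>g :: nat \<Rightarrow> real.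
     (\<Sum>u\<in>V. w u * g (p u)) = (\<Sum>k = 1..(q + 1) div 2. m k * (g k + g (q + 1 - k))))"

lemma mirror_symmetricD:
  "mirror_symmetric V w p q m \<Longrightarrow>
    (\<Sum>u\<in>V. w u * g (p u)) = (\<Sum>k = 1..(q + 1) div 2. m k * (g k + g (q + 1 - k)))"
  by (simp add: mirror_symmetric_def)

lemma mirror_symmetric_cong:
  assumes "mirror_symmetric V w p q m" "\<And>u. u \<in> V \<Longrightarrow> p u = p' u"
    and "\<And>k. k \<in> {1..(q + 1) div 2} \<Longrightarrow> m k = m' k"
  shows "mirror_symmetric V w p' q m'"
  using assms unfolding mirror_symmetric_def by (simp cong: sum.cong_simp)

lemma mirror_symmetric_Un:
  assumes "mirror_symmetric V w p q m" "mirror_symmetric V' w p q m'"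
    and "finite V" "finite V'" "V \<inter> V' = {}"
  shows "mirror_symmetric (V \<union> V') w p q (\<lambda>k. m k + m' k)"
  using assms unfolding mirror_symmetric_def
  by (simp add: sum.union_disjoint distrib_right sum.distrib del: Un_iff)

lemma mirror_symmetric_image:
  assumes "inj_on h V" "mirror_symmetric V (\<lambda>u. w (h u)) (\<lambda>u. p (h u)) q m"
  shows "mirror_symmetric (h ` V) w p q m"
  using assms by (simp add: mirror_symmetric_def sum.reindex)

lemma card_mirror_symmetric:
  assumes "mirror_symmetric V (\<lambda>_. 1) p q m" "finite V" "j \<in> {1..q}"
  shows "real (card {u \<in> V. p u = j}) = m (min j (q + 1 - j)) * (if 2 * j = q + 1 then 2 else 1)"
proof -
  let ?K = "{1..(q + 1) div 2}" and ?k = "min j (q + 1 - j)"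
  have "real (card {u \<in> V. p u = j}) = (\<Sum>u\<in>V. 1 * of_bool (p u = j))"
    using assms(2) by (simp add: Int_def)
  also have "\<dots> = (\<Sum>k\<in>?K. m k * (of_bool (k = j) + of_bool (q + 1 - k = j)))"
    by (rule mirror_symmetricD[OF assms(1)])
  also have "\<dots> = (\<Sum>k\<in>?K. if k = ?k then m k * (if 2 * j = q + 1 then 2 else 1) else 0)"
    using assms(3) by (intro sum.cong refl) (auto simp: min_def)
  also have "\<dots> = m ?k * (if 2 * j = q + 1 then 2 else 1)"
    using assms(3) by (subst sum.delta) auto
  finally show ?thesis .
qed

lemma double_sum_min:
  fixes m :: "nat \<Rightarrow> real"
  shows "(\<Sum>k = 1..n. \<Sum>l = 1..n. m k * m l * real (min k l)) =
    (\<Sum>k = 1..n. m k * (real k * m k + 2 * (\<Sum>l = 1..<k. real l * m l)))"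
proof (induction n)
  case (Suc n)
  have "(\<Sum>k = 1..Suc n. \<Sum>l = 1..Suc n. m k * m l * real (min k l)) =
     (\<Sum>k = 1..n. (\<Sum>l = 1..n. m k * m l * real (min k l)) + m k * m (Suc n) * real k)
     + (\<Sum>l = 1..n. m (Suc n) * m l * real l) + m (Suc n) * m (Suc n) * real (Suc n)"
    by (simp add: algebra_simps)
  also have "\<dots> = (\<Sum>k = 1..n. \<Sum>l = 1..n. m k * m l * real (min k l))
     + m (Suc n) * (real (Suc n) * m (Suc n) + 2 * (\<Sum>l = 1..<Suc n. real l * m l))"
    by (simp add: sum.distrib sum_distrib_left sum_distrib_right algebra_simps
        atLeastLessThanSuc_atLeastAtMost del: of_nat_Suc)
  finally show ?case using Suc by simp
qed simp

lemma mirror_pairs_distance: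
  fixes k l q :: nat
  assumes "2 * k \<le> q + 1" "2 * l \<le> q + 1"
  shows "\<bar>real k - real l\<bar> + \<bar>real k - real (q + 1 - l)\<bar>
    + (\<bar>real (q + 1 - k) - real l\<bar> + \<bar>real (q + 1 - k) - real (q + 1 - l)\<bar>)
    = 2 * (real q + 1) - 4 * real (min k l)"
  using assms by (auto simp: min_def of_nat_diff)

lemma mirror_symmetric_distance_sum:
  fixes w :: "'a \<Rightarrow> real"
  assumes "mirror_symmetric V w p q m"
  shows "1 / 2 * (\<Sum>u\<in>V. \<Sum>v\<in>V. w u * w v * \<bar>real (p u) - real (p v)\<bar>) =
    (real q + 1) / 4 * (\<Sum>u\<in>V. w u)\<^sup>2
    - (\<Sum>k = 1..(q + 1) div 2. 2 * m k * (real k * m k + 2 * (\<Sum>l = 1..<k. real l * m l)))"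
proof -
  let ?K = "{1..(q + 1) div 2}"
  define g where "g x = (\<Sum>l\<in>?K. m l * (\<bar>real x - real l\<bar> + \<bar>real x - real (q + 1 - l)\<bar>))" for x
  have total: "(\<Sum>u\<in>V. w u) = 2 * (\<Sum>k\<in>?K. m k)"
    using mirror_symmetricD[OF assms, of "\<lambda>_. 1"] by (simp add: sum_distrib_left mult.commute)
  have "(\<Sum>u\<in>V. \<Sum>v\<in>V. w u * w v * \<bar>real (p u) - real (p v)\<bar>) = (\<Sum>u\<in>V. w u * g (p u))"
    using mirror_symmetricD[OF assms, of "\<lambda>y. \<bar>real x - real y\<bar>" for x]
    by (simp add: g_def mult.assoc flip: sum_distrib_left)
  also have "\<dots> = (\<Sum>k\<in>?K. m k * (g k + g (q + 1 - k)))" by (rule mirror_symmetricD[OF assms])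
  also have "\<dots> = (\<Sum>k\<in>?K. \<Sum>l\<in>?K. m k * m l * (2 * (real q + 1) - 4 * real (min k l)))"
    unfolding g_def sum.distrib[symmetric] sum_distrib_left
    by (intro sum.cong refl, subst mirror_pairs_distance[symmetric]) (auto simp: algebra_simps)
  also have "\<dots> = 2 * (real q + 1) * (\<Sum>k\<in>?K. m k)\<^sup>2
      - 4 * (\<Sum>k\<in>?K. \<Sum>l\<in>?K. m k * m l * real (min k l))"
    by (simp add: power2_eq_square sum_product sum_distrib_left right_diff_distrib sum_subtractf
        ac_simps)
  finally show ?thesis
    unfolding double_sum_min total mult.assoc[of 2] sum_distrib_left[of 2, symmetric]
    by (simp add: power2_eq_square algebra_simps)
qed

lemma (in caterpillar) VWWI_mirror_symmetric:
  assumes "mirror_symmetric (S \<union> L) w pos q m"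
  shows "VWWI tree = (\<Sum>u \<in> S \<union> L. w u) * ((real q + 1) / 4 * (\<Sum>u \<in> S \<union> L. w u) + (\<Sum>u \<in> L. w u))
    - (\<Sum>u \<in> L. (w u)\<^sup>2)
    - (\<Sum>k = 1..(q + 1) div 2. 2 * m k * (real k * m k + 2 * (\<Sum>l = 1..<k. real l * m l)))"
  unfolding VWWI_tree mirror_symmetric_distance_sum[OF assms]
  by (simp add: power2_eq_square algebra_simps)

section \<open>The zigzag placement\<close>

text \<open>With \<open>B 0 = 0\<close>, the \<open>k\<close>-th block is \<open>{B (k - 1) + 1..B k}\<close>.\<close>

definition block_of :: "(nat \<Rightarrow> nat) \<Rightarrow> nat \<Rightarrow> nat" where
  "block_of B i = (LEAST k. i \<le> B k)"

definition zigzag :: "nat \<Rightarrow> (nat \<Rightarrow> nat) \<Rightarrow> nat \<Rightarrow> nat" where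
  "zigzag q B i = (if odd i then block_of B i else q + 1 - block_of B i)"

definition half_block_sum :: "(nat \<Rightarrow> real) \<Rightarrow> (nat \<Rightarrow> nat) \<Rightarrow> nat \<Rightarrow> real" where
  "half_block_sum f B k = (\<Sum>i = B (k - 1) + 1..B k. f i) / 2"

lemma block_of_eqI:
  assumes "mono B" "i \<in> {B (k - 1) + 1..B k}"
  shows "block_of B i = k"
  unfolding block_of_def
proof (rule Least_equality)
  fix l
  assume "i \<le> B l"
  then have "B (k - 1) < B l" using assms(2) by simp
  then have "\<not> l \<le> k - 1" using monoD[OF assms(1), of l "k - 1"] by auto
  then show "k \<le> l" by simp
qed (use assms(2) in simp)

lemma block_of_in:
  assumes "B 0 = 0" "i \<in> {1..B n}"
  shows "block_of B i \<in> {1..n}"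
proof -
  have "i \<le> B (block_of B i)" "block_of B i \<le> n"
    unfolding block_of_def using assms(2) by (auto intro: LeastI Least_le)
  moreover from this(1) have "block_of B i \<noteq> 0" using assms by (intro notI) simp
  ultimately show ?thesis by auto
qed

lemma zigzag_in:
  assumes "B 0 = 0" "i \<in> {1..B ((q + 1) div 2)}"
  shows "zigzag q B i \<in> {1..q}"
  using block_of_in[OF assms] by (auto simp: zigzag_def)

lemma sum_blocks:
  fixes B :: "nat \<Rightarrow> nat" and F :: "nat \<Rightarrow> 'a :: comm_monoid_add"
  assumes "mono B" "B 0 = 0"
  shows "(\<Sum>i = 1..B n. F i) = (\<Sum>k = 1..n. \<Sum>i = B (k - 1) + 1..B k. F i)"
proof (induction n)
  case (Suc n)
  have "B n \<le> B (Suc n)" using assms(1) by (simp add: monoD)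
  then have "{1..B (Suc n)} = {1..B n} \<union> {B n + 1..B (Suc n)}" by auto
  then have "(\<Sum>i = 1..B (Suc n). F i) = (\<Sum>i = 1..B n. F i) + (\<Sum>i = B n + 1..B (Suc n). F i)"
    by (simp add: sum.union_disjoint)
  then show ?case using Suc by simp
qed (simp add: assms(2))

lemma sum_pairs:
  fixes F :: "nat \<Rightarrow> 'a :: comm_monoid_add"
  shows "(\<Sum>i = 2 * a + 1..2 * b. F i) = (\<Sum>j = a + 1..b. F (2 * j - 1) + F (2 * j))"
proof (induction b)
  case (Suc b)
  show ?case
  proof (cases "a \<le> b")
    case True
    then show ?thesis using Suc by (simp add: ac_simps)
  qed simp
qed simp

lemma sum_alternating_pairs:
  fixes f :: "nat \<Rightarrow> real"
  assumes "even a" "even b" and paired: "\<And>j. a < 2 * j \<Longrightarrow> 2 * j \<le> b \<Longrightarrow> f (2 * j - 1) = f (2 * j)"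
  shows "(\<Sum>i = a + 1..b. f i * (if odd i then x else y)) = (\<Sum>i = a + 1..b. f i) / 2 * (x + y)"
proof -
  obtain a' b' where halves: "a = 2 * a'" "b = 2 * b'" using assms(1,2) by (elim evenE)
  have "(\<Sum>i = a + 1..b. f i * (if odd i then x else y)) = (\<Sum>j = a' + 1..b'. f (2 * j) * (x + y))"
    unfolding halves sum_pairs using paired by (intro sum.cong refl) (auto simp: halves distrib_left)
  also have "\<dots> = (\<Sum>j = a' + 1..b'. f (2 * j - 1) + f (2 * j)) / 2 * (x + y)"
    using paired by (simp add: halves sum_distrib_left sum_distrib_right sum_divide_distrib)
  finally show ?thesis unfolding halves sum_pairs .
qed

lemma mirror_symmetric_zigzag:
  fixes f :: "nat \<Rightarrow> real"
  assumes mono: "mono B" and zero: "B 0 = 0"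
    and even: "\<And>k. k \<le> q div 2 \<Longrightarrow> even (B k)"
    and paired: "\<And>j. 1 \<le> j \<Longrightarrow> 2 * j \<le> B (q div 2) \<Longrightarrow> f (2 * j - 1) = f (2 * j)"
  shows "mirror_symmetric {1..B ((q + 1) div 2)} f (zigzag q B) q (half_block_sum f B)"
  unfolding mirror_symmetric_def sum_blocks[OF mono zero] half_block_sum_def
proof (intro allI sum.cong refl)
  fix g :: "nat \<Rightarrow> real" and k
  assume k: "k \<in> {1..(q + 1) div 2}"
  have "(\<Sum>i = B (k - 1) + 1..B k. f i * g (zigzag q B i)) =
      (\<Sum>i = B (k - 1) + 1..B k. f i * (if odd i then g k else g (q + 1 - k)))"
    by (intro sum.cong refl) (simp only: zigzag_def block_of_eqI[OF mono] if_distrib[of g])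
  also have "\<dots> = (\<Sum>i = B (k - 1) + 1..B k. f i) / 2 * (g k + g (q + 1 - k))"
  proof (cases "k \<le> q div 2")
    case True
    then have "B k \<le> B (q div 2)" using monoD[OF mono] by blast
    then show ?thesis using True even paired by (intro sum_alternating_pairs) auto
  next
    case False
    then have "q + 1 - k = k" using k by auto
    then show ?thesis unfolding \<open>q + 1 - k = k\<close> by (simp flip: sum_distrib_right)
  qed
  finally show "(\<Sum>i = B (k - 1) + 1..B k. f i * g (zigzag q B i)) = \<dots>" .
qed

section \<open>Caterpillars for sequences of pairs\<close>

lemma nat_ceiling_half: "nat \<lceil>real k / 2\<rceil> = (k + 1) div 2"
  by linarith

locale paired_sequences =
  fixes n q :: nat and d :: "nat \<Rightarrow> nat" and \<mu> :: "nat \<Rightarrow> real"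
  assumes two_le_q: "2 \<le> q" and q_less_n: "q < n"
    and two_le_d: "i \<in> {1..q} \<Longrightarrow> 2 \<le> d i" and d_eq_1: "i \<in> {q + 1..n} \<Longrightarrow> d i = 1"
    and sum_d: "(\<Sum>i = 1..n. d i) = 2 * (n - 1)"
    and d_pair: "i \<in> {1..q div 2} \<Longrightarrow> d (2 * i - 1) = d (2 * i)"
    and \<mu>_spine_pair: "i \<in> {1..q div 2} \<Longrightarrow> \<mu> (2 * i - 1) = \<mu> (2 * i)"
    and \<mu>_leaf_pair: "i \<in> {1..(n - q) div 2} \<Longrightarrow> \<mu> (q + 2 * i - 1) = \<mu> (q + 2 * i)"
begin

lemma D_0: "D d 0 = 0"
  by (simp add: D_def)

lemma D_eq_sum: "1 \<le> k \<Longrightarrow> D d k = 2 + (\<Sum>i = 1..2 * k. d i - 2)"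
  using two_le_d[of 1] two_le_d[of 2] two_le_q by (auto simp: D_def numeral_2_eq_2)

lemma D_Suc:
  "D d (Suc k) = D d k + (if k = 0 then 2 else 0) + (d (2 * k + 1) - 2) + (d (2 * k + 2) - 2)"
  using D_eq_sum[of k] D_eq_sum[of "Suc k"] by (cases "k = 0") (simp_all add: D_0 numeral_2_eq_2)

lemma mono_D: "mono (D d)"
  by (simp add: mono_iff_le_Suc D_Suc)

lemma even_D: "k \<le> q div 2 \<Longrightarrow> even (D d k)"
  by (induction k) (use d_pair in \<open>fastforce simp: D_0 D_Suc\<close>)+

text \<open>
  For odd \<open>q\<close> the last summand \<open>d (q + 1) - 2\<close> is truncated to zero, so that the same formula
  counts the leaves for either parity of \<open>q\<close>.
\<close>

lemma D_half_q: "D d ((q + 1) div 2) = n - q"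
proof -
  have "D d ((q + 1) div 2) = 2 + (\<Sum>i = 1..2 * ((q + 1) div 2). d i - 2)"
    using two_le_q by (intro D_eq_sum) auto
  also have "(\<Sum>i = 1..2 * ((q + 1) div 2). d i - 2) = (\<Sum>i = 1..q. d i - 2)"
    using d_eq_1[of "q + 1"] q_less_n by (cases "even q") (auto elim!: oddE)
  finally have "D d ((q + 1) div 2) + 2 * q = 2 + (\<Sum>i = 1..q. (d i - 2) + 2)"
    by (simp add: sum.distrib del: add_2_eq_Suc')
  also have "\<dots> = 2 + (\<Sum>i = 1..q. d i)"
    using le_add_diff_inverse2[OF two_le_d] by (simp cong: sum.cong_simp)
  finally have "D d ((q + 1) div 2) + 2 * q = 2 + (\<Sum>i = 1..q. d i)" .
  moreover have "(\<Sum>i = 1..n. d i) = (\<Sum>i = 1..q. d i) + (n - q)"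
    using sum.ub_add_nat[of 1 q d "n - q"] d_eq_1 q_less_n by simp
  ultimately show ?thesis using sum_d q_less_n by simp
qed

definition spine_bound :: "nat \<Rightarrow> nat" where
  "spine_bound k = min (2 * k) q"

definition position :: "nat \<Rightarrow> nat" where
  "position i = (if i \<le> q then zigzag q spine_bound i else zigzag q (D d) (i - q))"

lemma mono_spine_bound: "mono spine_bound"
  by (auto simp: mono_def spine_bound_def)

lemma position_spine:
  assumes "i \<in> {1..q}"
  shows "position i = (if odd i then (i + 1) div 2 else q + 1 - (i + 1) div 2)"
proof -
  have "block_of spine_bound i = (i + 1) div 2"
    by (rule block_of_eqI[OF mono_spine_bound]) (use assms in \<open>auto simp: spine_bound_def\<close>)
  then show ?thesis using assms by (simp add: position_def zigzag_def)
qed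

lemma position_leaf_in:
  assumes "i \<in> {q + 1..n}"
  shows "position i \<in> {1..q}"
proof -
  have "i - q \<in> {1..D d ((q + 1) div 2)}" using assms unfolding D_half_q by auto
  then show ?thesis using assms zigzag_in[of "D d", OF D_0] by (simp add: position_def)
qed

lemma bij_betw_position: "bij_betw position {1..q} {1..q}"
proof -
  have "inj_on position {1..q}"
    by (rule inj_onI) (auto simp: position_spine split: if_splits elim!: evenE oddE)
  moreover have "position ` {1..q} \<subseteq> {1..q}" by (auto simp: position_spine elim!: evenE)
  ultimately show ?thesis by (simp add: bij_betw_def endo_inj_surj)
qed

sublocale caterpillar "{1..q}" "{q + 1..n}" q position \<mu>
  using two_le_q bij_betw_position position_leaf_in by unfold_locales auto

lemma spine_Un_leaves: "{1..q} \<union> {q + 1..n} = {1..n}"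
  using q_less_n by auto

lemma mirror_symmetric_spine: "mirror_symmetric {1..q} \<mu> position q (half_block_sum \<mu> spine_bound)"
proof -
  have "mirror_symmetric {1..spine_bound ((q + 1) div 2)} \<mu> (zigzag q spine_bound) q
      (half_block_sum \<mu> spine_bound)"
    using \<mu>_spine_pair
    by (intro mirror_symmetric_zigzag mono_spine_bound) (auto simp: spine_bound_def min_def)
  moreover have "spine_bound ((q + 1) div 2) = q" by (auto simp: spine_bound_def)
  ultimately have
    "mirror_symmetric {1..q} \<mu> (zigzag q spine_bound) q (half_block_sum \<mu> spine_bound)"
    by simp
  then show ?thesis by (rule mirror_symmetric_cong) (simp_all add: position_def)
qed

lemma mirror_symmetric_leaves:
  assumes "\<And>i. i \<in> {1..(n - q) div 2} \<Longrightarrow> f (q + 2 * i - 1) = f (q + 2 * i)"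
  shows "mirror_symmetric {q + 1..n} f position q (half_block_sum (\<lambda>i. f (q + i)) (D d))"
proof -
  let ?m = "half_block_sum (\<lambda>i. f (q + i)) (D d)"
  have "D d (q div 2) \<le> n - q"
    unfolding D_half_q[symmetric] by (intro monoD[OF mono_D]) simp
  then have "mirror_symmetric {1..D d ((q + 1) div 2)} (\<lambda>i. f (q + i)) (zigzag q (D d)) q ?m"
    using assms by (intro mirror_symmetric_zigzag mono_D D_0 even_D) auto
  then have "mirror_symmetric {1..n - q} (\<lambda>i. f (q + i)) (\<lambda>i. position (q + i)) q ?m"
    unfolding D_half_q by (rule mirror_symmetric_cong) (simp_all add: position_def)
  then have "mirror_symmetric ((+) q ` {1..n - q}) f position q ?m"
    by (intro mirror_symmetric_image) auto
  then show ?thesis using q_less_n by simp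
qed

lemma sum_last_block:
  assumes "odd q"
  shows "(\<Sum>i = D d (q div 2) + 1..D d (q div 2 + 1). \<mu> (q + i)) = (\<Sum>i<d q - 2. \<mu> (n - i))"
proof -
  obtain h where q: "q = 2 * h + 1" using assms by (elim oddE)
  then have "D d h + (d q - 2) = n - q"
    using D_half_q D_Suc[of h] d_eq_1[of "q + 1"] two_le_q q_less_n by simp
  moreover have "D d (h + 1) = n - q" using D_half_q q by simp
  ultimately show ?thesis
    using q by (intro sum.reindex_bij_witness[of _ "\<lambda>i. n - q - i" "\<lambda>i. n - q - i"]) auto
qed

lemma M_eq_half_block_sums:
  assumes "k \<in> {1..(q + 1) div 2}"
  shows "M n q \<mu> d k = half_block_sum \<mu> spine_bound k + half_block_sum (\<lambda>i. \<mu> (q + i)) (D d) k"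
proof (cases "k \<le> q div 2")
  case True
  then have "{spine_bound (k - 1) + 1..spine_bound k} = {2 * k - 1, 2 * k}" "2 * k - 1 \<noteq> 2 * k"
    using assms by (auto simp: spine_bound_def)
  then show ?thesis using True assms by (simp add: M_def half_block_sum_def add_divide_distrib)
next
  case False
  then have k: "odd q" "k = q div 2 + 1" using assms by (auto elim!: evenE)
  then have "{spine_bound (k - 1) + 1..spine_bound k} = {q}"
    by (auto simp: spine_bound_def elim!: oddE)
  then show ?thesis
    using False k sum_last_block by (simp add: M_def half_block_sum_def add_divide_distrib)
qed

lemma mirror_symmetric_M: "mirror_symmetric ({1..q} \<union> {q + 1..n}) \<mu> position q (M n q \<mu> d)"
  using mirror_symmetric_Un[OF mirror_symmetric_spine mirror_symmetric_leaves[OF \<mu>_leaf_pair]]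
  by (rule mirror_symmetric_cong) (auto simp: M_eq_half_block_sums)

lemma card_leaves_at_spine:
  assumes "v \<in> {1..q}"
  shows "card {x \<in> {q + 1..n}. position x = position v} = (if v \<le> 2 then d v - 1 else d v - 2)"
proof -
  define k where "k = (v + 1) div 2"
  have layer: "k \<in> {1..(q + 1) div 2}" "v \<in> {2 * k - 1, 2 * k}" using assms by (auto simp: k_def)
  have block:
    "D d k = D d (k - 1) + (if k = 1 then 2 else 0) + (d (2 * k - 1) - 2) + (d (2 * k) - 2)"
    using D_Suc[of "k - 1"] layer by (cases k) auto
  have "position v \<in> {1..q}" "min (position v) (q + 1 - position v) = k"
    "2 * position v = q + 1 \<longleftrightarrow> 2 * k = q + 1"
    using layer by (auto simp: position_spine[OF assms] k_def[symmetric])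
  moreover have "mirror_symmetric {q + 1..n} (\<lambda>_. 1) position q (half_block_sum (\<lambda>_. 1) (D d))"
    by (rule mirror_symmetric_leaves) simp
  ultimately have card: "real (card {x \<in> {q + 1..n}. position x = position v}) =
      real (D d k - D d (k - 1)) / 2 * (if 2 * k = q + 1 then 2 else 1)"
    using card_mirror_symmetric[of "{q + 1..n}" position q _ "position v"]
    by (simp add: half_block_sum_def)
  consider (paired) "k \<le> q div 2" | (central) "2 * k = q + 1" "v = q"
    using layer assms by fastforce
  then have "real (D d k - D d (k - 1)) / 2 * (if 2 * k = q + 1 then 2 else 1) =
      real (if v \<le> 2 then d v - 1 else d v - 2)"
  proof cases
    case paired
    then have "d (2 * k - 1) = d (2 * k)" "d v = d (2 * k)" "2 \<le> d v"
      using layer d_pair[of k] two_le_d[OF assms] by auto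
    then show ?thesis using block paired layer by auto
  next
    case central
    then have "3 \<le> q" using two_le_q by presburger
    then show ?thesis using central block layer d_eq_1[of "q + 1"] q_less_n by auto
  qed
  with card show ?thesis by linarith
qed

lemma degree_tree_eq:
  assumes "v \<in> {1..n}"
  shows "degree tree v = d v"
proof (cases "v \<le> q")
  case True
  then have v: "v \<in> {1..q}" using assms by simp
  have "1 < position v \<and> position v < q \<longleftrightarrow> 2 < v" "1 < position v \<or> position v < q"
    using v two_le_q by (auto simp: position_spine elim!: oddE evenE)
  then show ?thesis
    using two_le_d[OF v] card_leaves_at_spine[OF v] unfolding degree_spine[OF v] by auto
next
  case False
  then show ?thesis using assms degree_leaf d_eq_1 by simp
qed

lemma tree_in_WT: "tree \<in> WT n \<mu> d"
proof -
  have "verts tree = {1..n}" by (rule trans[OF verts_tree spine_Un_leaves])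
  then have "bij_betw id {1..n} (verts tree)" by (simp only: bij_betw_id)
  moreover have "degree tree (id i) = d i \<and> weight tree (id i) = \<mu> i" if "i \<in> {1..n}" for i
    unfolding weight_tree id_apply using degree_tree_eq[OF that] by blast
  ultimately show ?thesis unfolding WT_def using is_tree_tree by blast
qed

lemma VWWI_tree_eq_UB: "VWWI tree = UB n q \<mu> d"
  using VWWI_mirror_symmetric[OF mirror_symmetric_M]
  unfolding spine_Un_leaves UB_def Let_def nat_ceiling_half by simp

end

theorem theorem2:
  fixes n q :: nat and d :: "nat \<Rightarrow> nat" and \<mu> :: "nat \<Rightarrow> real"
  assumes "4 \<le> q" and "q < n"
    and "\<And>i. i \<in> {1..n} \<Longrightarrow> 0 < d i"
    and "\<And>i j. 1 \<le> i \<Longrightarrow> i \<le> j \<Longrightarrow> j \<le> n \<Longrightarrow> d j \<le> d i"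
    and "\<And>i. i \<in> {1..q} \<Longrightarrow> 2 \<le> d i"
    and "\<And>i. i \<in> {q + 1..n} \<Longrightarrow> d i = 1"
    and "(\<Sum>i = 1..n. d i) = 2 * (n - 1)"
    and "\<And>i. i \<in> {1..n} \<Longrightarrow> 0 \<le> \<mu> i"
    and "\<And>i j. 1 \<le> i \<Longrightarrow> i < j \<Longrightarrow> j \<le> n \<Longrightarrow> d i = d j \<Longrightarrow> \<mu> j \<le> \<mu> i"
    and "monotone_in n \<mu> d"
    and "\<And>i. i \<in> {1..q div 2} \<Longrightarrow> \<mu> (2 * i - 1) = \<mu> (2 * i) \<and> d (2 * i - 1) = d (2 * i)"
    and "\<And>i. i \<in> {1..(n - q) div 2} \<Longrightarrow> \<mu> (q + 2 * i - 1) = \<mu> (q + 2 * i)"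
  shows "\<exists>T :: nat weighted_graph. T \<in> WT n \<mu> d \<and> VWWI T = UB n q \<mu> d"
proof -
  interpret paired_sequences n q d \<mu>
    using assms by unfold_locales auto
  show ?thesis using tree_in_WT VWWI_tree_eq_UB by blast
qed

end
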